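(* Let $x^*$ be a local (or global) minimizer of $h=f+g$, let $r'>0$, and let $(x^k)$ be generated by iPiano with $U=B_{r'}(x^* )$ (see context for the algorithm, the assumptions on $f,g,h$ and the admissible step-size parameters). Let $H_\kappa(x,y)=h(x)+\kappa|x-y|^2$ on $\mathbb R^{2N}$, with $\kappa>0$ and $a>0$ as in the context. Then $z^*=(x^*,x^* )$ is a local (or global) minimizer of $H_\kappa$. Suppose that the following growth condition holds for $H_\kappa$ at $z^*=(z_1^*,z_2^* )$: for any $\delta>0$ there exist $0<\rho<\delta$ and $\nu>0$ such that $$z\in B_\rho(z^* ),\ H_\kappa(z)<H_\kappa(z^* )+\nu,\ y=(y_1,y_2)\in\mathbb R^{2N},\ y_2\notin B_\delta(z_2^* )\ \Rightarrow\ H_\kappa(z)<H_\kappa(y)+\tfrac a4|z_2-y_2|^2.$$ Suppose also that $H_\kappa$ has the KL property at $z^*$. Then, for any $r>0$ (in particular for $r=r'$), there exist $u\in(0,r)$ and $\mu>0$ such that the conditions $$x^0\in B_u(x^* ),\qquad h(x^* )<h(x^0)<h(x^* )+\mu,$$ imply that the sequence $(x^k)$ has the finite length property $\sum_{k=1}^\infty|x^k-x^{k-1}|<+\infty$, remains in $B_r(x^* )$, and converges to some $\bar x\in B_r(x^* )$, a critical point of $h$ with $h(\bar x)=h(x^* )$. For $r$ sufficiently small, $\bar x$ is a local minimizer of $h$.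
   Context: $|\cdot|$ is the Euclidean norm, $\overline{\mathbb R}=\mathbb R\cup\{+\infty\}$, $B_\varepsilon(\bar x)=\{x: |x-\bar x|\le\varepsilon\}$. For $z\in\mathbb R^{2N}$ write $z=(z_1,z_2)$ with $z_1,z_2\in\mathbb R^N$. Problem: minimize $h(x)=f(x)+g(x)$ over $x\in\mathbb R^N$, $h\colon\mathbb R^N\to\overline{\mathbb R}$ proper lsc. Assumption on $U\subset\mathbb R^N$: $f\colon U\to\mathbb R$ is $C^1$ (possibly non-convex) with $L$-Lipschitz continuous gradient on $\operatorname{dom}g\cap U$, $L>0$; $g\colon U\to\overline{\mathbb R}$ is proper, lsc, possibly non-smooth and non-convex, prox-bounded, and simple (informally: its proximal map can be evaluated to global optimality); $h$ restricted to $U$ is bounded from below and coercive ($|x|\to\infty$ with $x\in U$ implies $h(x)\to\infty$; this is void for bounded $U$). Prox-bounded means that $\inf_w g(w)+\frac1{2\lambda}|w-x|^2>-\infty$ for some $\lambda>0$ and some $x$. iPiano: choose $x^0\in\operatorname{dom}h\cap U$, set $x^{-1}=x^0$, and for $k\ge0$ $$y^k=x^k+\beta(x^k-x^{k-1}),\qquad x^{k+1}\in\arg\min_{x\in\mathbb R^N}\ g(x)+\langle\nabla f(x^k),x-x^k\rangle+\tfrac1{2\alpha}|x-y^k|^2 .$$ Admissible constant parameters: - $g$ convex (including $g\equiv0$, the Heavy-ball method): $\beta\in[0,1)$, $\alpha\in(0,2(1-\beta)/L)$; - $g$ non-convex: $\beta\in[0,\frac12)$, $\alpha\in(0,(1-2\beta)/L)$;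 - $g$ $m$-semi-convex, $m<L$ (i.e. $m\in\mathbb R$ is the largest value such that $g-\frac m2|\cdot|^2$ is convex): $\beta\in[0,1)$, $\alpha\in(0,2(1-\beta)/(L-m))$; - special cases: $f\equiv0$, $g$ convex: $\beta=0$, $\alpha>0$; $g$ convex, $\beta=0$, $\alpha\in(0,2/L)$; $g$ non-convex, $\beta=0$, $\alpha\in(0,1/L)$. The constant $\kappa>0$, together with constants $a,b>0$, is such that the sequence $z^k=(x^k,x^{k-1})$ generated by iPiano satisfies the following for $\mathcal F=H_\kappa$ (existence of such constants is known): - (sufficient descent) for each $k\ge0$, $\mathcal F(z^{k+1})+a|x^k-x^{k-1}|^2\le\mathcal F(z^k)$; - (relative error) for each $k\ge0$ there is $w^{k+1}\in\partial\mathcal F(z^{k+1})$ with $|w^{k+1}|\le\frac b2(|x^k-x^{k-1}|+|x^{k+1}-x^k|)$; - (continuity) there is a subsequence with $z^{k_j}\to\tilde z$ and $\mathcal F(z^{k_j})\to\mathcal F(\tilde z)$. The constant $a$ in the growth condition of the claim is the same as in this sufficient descent condition. Here $\partial$ is the limiting subdifferential (limits $v$ of Fréchet subgradients $v^n\in\widehat\partial f(x^n)$ with $x^n\to\bar x$, $f(x^n)\to f(\bar x)$); a critical point is a point with $0\in\partial f$. KL property: $f\colon\mathbb R^n\to\overline{\mathbb R}$ has the KL property at $\bar x\in\operatorname{dom}\partial f$ if there exist $\eta\in(0,\infty]$, a neighborhood $V$ of $\bar x$ and a continuous concave $\varphi\colon[0,\eta)\to\mathbb R_+$ with $\varphi(0)=0$,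 $\varphi\in C^1((0,\eta))$, $\varphi'>0$ on $(0,\eta)$, such that $\varphi'(f(x)-f(\bar x))\inf_{v\in\partial f(x)}|v|\ge1$ for all $x\in V$ with $f(\bar x)<f(x)<f(\bar x)+\eta$ ($\inf\emptyset=+\infty$). *)

theory Defs
  imports "HOL-Analysis.Analysis"
begin

section \<open>Extended-real-valued functions\<close>

definition dom_on :: "'a set \<Rightarrow> ('a \<Rightarrow> ereal) \<Rightarrow> 'a set" where
  "dom_on S f = {x \<in> S. f x < \<infinity>}"

definition proper_on :: "'a set \<Rightarrow> ('a \<Rightarrow> ereal) \<Rightarrow> bool" where
  "proper_on S f \<longleftrightarrow> (\<forall>x\<in>S. f x \<noteq> - \<infinity>) \<and> dom_on S f \<noteq> {}"

definition lsc_on :: "'a::topological_space set \<Rightarrow> ('a \<Rightarrow> ereal) \<Rightarrow> bool" where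
  "lsc_on S f \<longleftrightarrow> (\<forall>x\<in>S. f x \<le> Liminf (at x within S) f)"

text \<open>The multiplication on \<^typ>\<open>ereal\<close> satisfies \<open>0 * \<infinity> = 0\<close>, so the boundary cases of the
  convex combination are harmless.\<close>

definition ereal_convex_on :: "'a::real_vector set \<Rightarrow> ('a \<Rightarrow> ereal) \<Rightarrow> bool" where
  "ereal_convex_on S f \<longleftrightarrow> convex S \<and>
     (\<forall>x\<in>S. \<forall>y\<in>S. \<forall>u\<ge>0. \<forall>v\<ge>0. u + v = 1 \<longrightarrow>
        f (u *\<^sub>R x + v *\<^sub>R y) \<le> ereal u * f x + ereal v * f y)"

definition semi_convex_on :: "real \<Rightarrow> 'a::real_normed_vector set \<Rightarrow> ('a \<Rightarrow> ereal) \<Rightarrow> bool" where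
  "semi_convex_on m S f \<longleftrightarrow>
     (let C = (\<lambda>c. ereal_convex_on S (\<lambda>x. f x - ereal (c / 2 * (norm x)\<^sup>2)))
      in C m \<and> (\<forall>c. C c \<longrightarrow> c \<le> m))"

definition prox_bounded_on :: "'a::real_normed_vector set \<Rightarrow> ('a \<Rightarrow> ereal) \<Rightarrow> bool" where
  "prox_bounded_on S f \<longleftrightarrow>
     (\<exists>lam>0. \<exists>x. (INF w\<in>S. f w + ereal (1 / (2 * lam) * (norm (w - x))\<^sup>2)) > - \<infinity>)"

text \<open>For bounded \<open>S\<close> the filter below is trivial, so the condition holds vacuously.\<close>

definition coercive_on :: "'a::real_normed_vector set \<Rightarrow> ('a \<Rightarrow> ereal) \<Rightarrow> bool" where
  "coercive_on S f \<longleftrightarrow> (f \<longlongrightarrow> \<infinity>) (inf at_infinity (principal S))"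

definition local_minimizer :: "('a::metric_space \<Rightarrow> ereal) \<Rightarrow> 'a \<Rightarrow> bool" where
  "local_minimizer f x \<longleftrightarrow> f x < \<infinity> \<and> (\<exists>e>0. \<forall>y\<in>cball x e. f x \<le> f y)"

definition global_minimizer :: "('a \<Rightarrow> ereal) \<Rightarrow> 'a \<Rightarrow> bool" where
  "global_minimizer f x \<longleftrightarrow> f x < \<infinity> \<and> (\<forall>y. f x \<le> f y)"


section \<open>Limiting subdifferential and the Kurdyka-Lojasiewicz property\<close>

definition frechet_subdiff :: "('a::euclidean_space \<Rightarrow> ereal) \<Rightarrow> 'a \<Rightarrow> 'a set" where
  "frechet_subdiff f x = {v. \<bar>f x\<bar> \<noteq> \<infinity> \<and>
     0 \<le> Liminf (at x) (\<lambda>y. (f y - f x - ereal (v \<bullet> (y - x))) / ereal (norm (y - x)))}"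

definition limiting_subdiff :: "('a::euclidean_space \<Rightarrow> ereal) \<Rightarrow> 'a \<Rightarrow> 'a set" where
  "limiting_subdiff f x = {v. \<bar>f x\<bar> \<noteq> \<infinity> \<and>
     (\<exists>xs vs. (\<forall>n::nat. vs n \<in> frechet_subdiff f (xs n)) \<and>
        xs \<longlonglongrightarrow> x \<and> (\<lambda>n. f (xs n)) \<longlonglongrightarrow> f x \<and> vs \<longlonglongrightarrow> v)}"

definition critical_point :: "('a::euclidean_space \<Rightarrow> ereal) \<Rightarrow> 'a \<Rightarrow> bool" where
  "critical_point f x \<longleftrightarrow> 0 \<in> limiting_subdiff f x"

text \<open>In \<^typ>\<open>ereal\<close> the infimum of the empty set is \<open>\<infinity>\<close>. The argument of \<open>\<phi>'\<close> is only evaluated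
  where both function values are finite.\<close>

definition KL_property_at :: "('a::euclidean_space \<Rightarrow> ereal) \<Rightarrow> 'a \<Rightarrow> bool" where
  "KL_property_at f xb \<longleftrightarrow> limiting_subdiff f xb \<noteq> {} \<and>
     (\<exists>(\<eta>::ereal) V (\<phi> :: real \<Rightarrow> real) (\<phi>' :: real \<Rightarrow> real).
        0 < \<eta> \<and> open V \<and> xb \<in> V \<and>
        continuous_on {t. 0 \<le> t \<and> ereal t < \<eta>} \<phi> \<and>
        concave_on {t. 0 \<le> t \<and> ereal t < \<eta>} \<phi> \<and>
        (\<forall>t. 0 \<le> t \<and> ereal t < \<eta> \<longrightarrow> 0 \<le> \<phi> t) \<and>
        \<phi> 0 = 0 \<and>
        (\<forall>t. 0 < t \<and> ereal t < \<eta> \<longrightarrow> (\<phi> has_real_derivative \<phi>' t) (at t) \<and> 0 < \<phi>' t) \<and>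
        continuous_on {t. 0 < t \<and> ereal t < \<eta>} \<phi>' \<and>
        (\<forall>x\<in>V. f xb < f x \<and> f x < f xb + \<eta> \<longrightarrow>
           1 \<le> ereal (\<phi>' (real_of_ereal (f x - f xb))) *
               (INF v\<in>limiting_subdiff f x. ereal (norm v))))"


section \<open>iPiano\<close>

text \<open>The functions are total; the regularity assumptions concern only their restrictions to \<open>U\<close>.
  The map \<open>G\<close> is the gradient of \<open>f\<close> on \<open>U\<close>; its values outside \<open>U\<close> are unconstrained.\<close>

definition ipiano_problem ::
  "('a::euclidean_space \<Rightarrow> real) \<Rightarrow> ('a \<Rightarrow> 'a) \<Rightarrow> ('a \<Rightarrow> ereal) \<Rightarrow> real \<Rightarrow> 'a set \<Rightarrow> bool" where
  "ipiano_problem f G g L U \<longleftrightarrow>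
     (let h = (\<lambda>x. ereal (f x) + g x) in
      proper_on UNIV h \<and> lsc_on UNIV h \<and>
      (\<forall>x\<in>U. (f has_derivative (\<lambda>v. G x \<bullet> v)) (at x within U)) \<and> continuous_on U G \<and>
      0 < L \<and> L-lipschitz_on (dom_on U g) G \<and>
      proper_on U g \<and> lsc_on U g \<and> prox_bounded_on U g \<and>
      (\<exists>c::real. \<forall>x\<in>U. ereal c \<le> h x) \<and> coercive_on U h)"

definition admissible_parameters ::
  "('a::euclidean_space \<Rightarrow> real) \<Rightarrow> ('a \<Rightarrow> ereal) \<Rightarrow> real \<Rightarrow> 'a set \<Rightarrow> real \<Rightarrow> real \<Rightarrow> bool" where
  "admissible_parameters f g L U \<alpha> \<beta> \<longleftrightarrow>
     (ereal_convex_on U g \<and> 0 \<le> \<beta> \<and> \<beta> < 1 \<and> 0 < \<alpha> \<and> \<alpha> < 2 * (1 - \<beta>) / L) \<or>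
     (\<not> ereal_convex_on U g \<and> 0 \<le> \<beta> \<and> \<beta> < 1/2 \<and> 0 < \<alpha> \<and> \<alpha> < (1 - 2 * \<beta>) / L) \<or>
     (\<exists>m<L. semi_convex_on m U g \<and>
        0 \<le> \<beta> \<and> \<beta> < 1 \<and> 0 < \<alpha> \<and> \<alpha> < 2 * (1 - \<beta>) / (L - m)) \<or>
     ((\<forall>x\<in>U. f x = 0) \<and> ereal_convex_on U g \<and> \<beta> = 0 \<and> 0 < \<alpha>) \<or>
     (ereal_convex_on U g \<and> \<beta> = 0 \<and> 0 < \<alpha> \<and> \<alpha> < 2 / L) \<or>
     (\<not> ereal_convex_on U g \<and> \<beta> = 0 \<and> 0 < \<alpha> \<and> \<alpha> < 1 / L)"

text \<open>Here and below \<open>x (k - 1)\<close> uses truncated subtraction on \<^typ>\<open>nat\<close>: for \<open>k = 0\<close> it denotes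
  \<open>x 0\<close>, which is exactly the initialisation of the algorithm (the iterate preceding the first one
  equals the first one).\<close>

definition ipiano_sequence ::
  "('a::euclidean_space \<Rightarrow> real) \<Rightarrow> ('a \<Rightarrow> 'a) \<Rightarrow> ('a \<Rightarrow> ereal) \<Rightarrow> 'a set \<Rightarrow> real \<Rightarrow> real \<Rightarrow> (nat \<Rightarrow> 'a) \<Rightarrow> bool" where
  "ipiano_sequence f G g U \<alpha> \<beta> x \<longleftrightarrow>
     x 0 \<in> dom_on U (\<lambda>p. ereal (f p) + g p) \<and>
     (\<forall>k. let y = x k + \<beta> *\<^sub>R (x k - x (k - 1)) in
        is_arg_min (\<lambda>p. g p + ereal (G (x k) \<bullet> (p - x k)) + ereal (1 / (2 * \<alpha>) * (norm (p - y))\<^sup>2))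
          (\<lambda>_. True) (x (Suc k)))"

definition H_fun :: "('a::real_normed_vector \<Rightarrow> ereal) \<Rightarrow> real \<Rightarrow> 'a \<times> 'a \<Rightarrow> ereal" where
  "H_fun h \<kappa> z = h (fst z) + ereal (\<kappa> * (norm (fst z - snd z))\<^sup>2)"

definition paired :: "(nat \<Rightarrow> 'a) \<Rightarrow> nat \<Rightarrow> 'a \<times> 'a" where
  "paired x k = (x k, x (k - 1))"

definition sufficient_descent ::
  "('a::euclidean_space \<times> 'a \<Rightarrow> ereal) \<Rightarrow> real \<Rightarrow> (nat \<Rightarrow> 'a) \<Rightarrow> bool" where
  "sufficient_descent F a x \<longleftrightarrow>
     (\<forall>k. F (paired x (Suc k)) + ereal (a * (norm (x k - x (k - 1)))\<^sup>2) \<le> F (paired x k))"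

definition relative_error ::
  "('a::euclidean_space \<times> 'a \<Rightarrow> ereal) \<Rightarrow> real \<Rightarrow> (nat \<Rightarrow> 'a) \<Rightarrow> bool" where
  "relative_error F b x \<longleftrightarrow>
     (\<forall>k. \<exists>w\<in>limiting_subdiff F (paired x (Suc k)).
        norm w \<le> b / 2 * (norm (x k - x (k - 1)) + norm (x (Suc k) - x k)))"

definition subsequence_continuity ::
  "('a::euclidean_space \<times> 'a \<Rightarrow> ereal) \<Rightarrow> (nat \<Rightarrow> 'a) \<Rightarrow> bool" where
  "subsequence_continuity F x \<longleftrightarrow>
     (\<exists>j zt. strict_mono (j :: nat \<Rightarrow> nat) \<and> (\<lambda>i. paired x (j i)) \<longlonglongrightarrow> zt \<and>
        (\<lambda>i. F (paired x (j i))) \<longlonglongrightarrow> F zt)"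

definition growth_condition ::
  "('a::euclidean_space \<times> 'a \<Rightarrow> ereal) \<Rightarrow> real \<Rightarrow> 'a \<times> 'a \<Rightarrow> bool" where
  "growth_condition F a zs \<longleftrightarrow>
     (\<forall>\<delta>>0. \<exists>\<rho> \<nu>::real. 0 < \<rho> \<and> \<rho> < \<delta> \<and> 0 < \<nu> \<and>
        (\<forall>z y. z \<in> cball zs \<rho> \<and> F z < F zs + ereal \<nu> \<and> snd y \<notin> cball (snd zs) \<delta> \<longrightarrow>
           F z < F y + ereal (a / 4 * (norm (snd z - snd y))\<^sup>2)))"

end

theory Submission
  imports Defs
begin

text \<open>The iterates are kept near \<open>xstar\<close> by an induction with three ingredients. The growth condition,
  applied to \<open>z\<^sup>k\<close> and \<open>z\<^sup>k\<^sup>+\<^sup>2\<close>, prevents \<open>x\<^sup>k\<^sup>+\<^sup>1\<close> from leaving a ball on which \<open>h \<ge> h xstar\<close>, so the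
  values \<open>H\<^sub>\<kappa> (z\<^sup>k\<^sup>+\<^sup>1)\<close> stay above the minimal one. The term \<open>\<kappa> |x\<^sup>k\<^sup>+\<^sup>1 - x\<^sup>k|\<^sup>2\<close> of \<open>H\<^sub>\<kappa>\<close> makes a single
  step small. The Kurdyka-Lojasiewicz inequality bounds the sum of all previous steps by a
  telescoping sum of values of the desingularizing function. Taking the radius small compared to that
  of the minimality of \<open>xstar\<close> makes the limit point a local minimizer, hence critical.\<close>

section \<open>Inequalities for sums of steps and for concave functions\<close>

text \<open>Each \<open>d (Suc i)\<close> is charged a quarter by its own inequality and a quarter
  by the next one, so half of the sum is absorbed while the \<open>p\<close> terms telescope. After
  \<open>n\<close> inequalities the last step has been charged only once; this is the surplus
  \<open>d n / 4\<close> that strengthens the induction hypothesis.\<close>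

lemma summed_step_bound:
  fixes d p :: "nat \<Rightarrow> real"
  assumes "d 0 = 0" and nonneg: "\<And>i. 0 \<le> d i"
    and step: "\<And>i. i < n \<Longrightarrow> d (Suc i) \<le> (d i + d (Suc i)) / 4 + (p (Suc i) - p (Suc (Suc i)))"
  shows "(\<Sum>i<n. d (Suc i)) \<le> 2 * (p 1 - p (Suc n))"
proof -
  have "(\<Sum>i<n. d (Suc i)) / 2 + d n / 4 \<le> p 1 - p (Suc n)"
    using step
  proof (induction n)
    case 0
    then show ?case using \<open>d 0 = 0\<close> by simp
  next
    case (Suc n)
    have "(\<Sum>i<n. d (Suc i)) / 2 + d n / 4 \<le> p 1 - p (Suc n)"
      using Suc by simp
    with Suc.prems[of n] show ?case by simp argo
  qed
  then show ?thesis using nonneg[of n] by simp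
qed

text \<open>This is the tangent inequality of the convex function \<open>- \<phi>\<close>. Only
  \<open>s\<close> has to be interior, so \<open>t\<close> may be the endpoint 0 of the domain of a
  desingularizing function. It turns a decrease of function values into a decrease of
  \<phi>.\<close>

lemma concave_above_chord_slope:
  fixes \<phi> :: "real \<Rightarrow> real"
  assumes "concave_on A \<phi>" "connected A" "s \<in> interior A" "t \<in> A"
    and "(\<phi> has_real_derivative D) (at s)"
  shows "D * (s - t) \<le> \<phi> s - \<phi> t"
proof -
  have "convex_on A (\<lambda>x. - \<phi> x)" using assms(1) by (simp add: concave_on_def)
  moreover have "((\<lambda>x. - \<phi> x) has_real_derivative - D) (at s within A)"
    using assms(5) by (rule has_field_derivative_at_within[OF DERIV_minus])
  ultimately have "- \<phi> t - - \<phi> s \<ge> - D * (t - s)"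
    using convex_on_imp_above_tangent assms(2-4) by blast
  then show ?thesis by (simp add: algebra_simps)
qed

section \<open>The Kurdyka-Lojasiewicz property with real constants\<close>

text \<open>Shrinking the extended bound to a real \<eta> and the neighbourhood to a closed ball
  keeps the later estimates in the reals. As \<open>\<phi>'\<close> is positive, the infimum can be
  replaced by any single subgradient. Continuity of \<phi> is kept only as smallness near 0,
  concavity only as the tangent inequality, with \<open>t = 0\<close> allowed.\<close>

lemma KL_property_atE:
  assumes KL: "KL_property_at F z" and z: "F z = ereal c"
  obtains \<eta> \<delta> :: real and \<phi> \<phi>' :: "real \<Rightarrow> real"
  where "0 < \<eta>" "0 < \<delta>" "\<phi> 0 = 0"
    and "\<And>t. 0 \<le> t \<Longrightarrow> t < \<eta> \<Longrightarrow> 0 \<le> \<phi> t"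
    and "\<And>e. 0 < e \<Longrightarrow> \<exists>\<mu>>0. \<forall>t. 0 \<le> t \<longrightarrow> t < \<mu> \<longrightarrow> \<phi> t < e"
    and "\<And>t. 0 < t \<Longrightarrow> t < \<eta> \<Longrightarrow> 0 < \<phi>' t"
    and "continuous_on {0<..<\<eta>} \<phi>'"
    and "\<And>s t. 0 < s \<Longrightarrow> s < \<eta> \<Longrightarrow> 0 \<le> t \<Longrightarrow> t < \<eta> \<Longrightarrow> \<phi>' s * (s - t) \<le> \<phi> s - \<phi> t"
    and "\<And>y s v. y \<in> cball z \<delta> \<Longrightarrow> F y = ereal (c + s) \<Longrightarrow> 0 < s \<Longrightarrow> s < \<eta> \<Longrightarrow>
           v \<in> limiting_subdiff F y \<Longrightarrow> 1 \<le> \<phi>' s * norm v"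
proof -
  obtain \<eta>' V \<phi> \<phi>' where
    \<eta>': "0 < \<eta>'" and V: "open V" "z \<in> V"
    and cont: "continuous_on {t. 0 \<le> t \<and> ereal t < \<eta>'} \<phi>"
    and conc: "concave_on {t. 0 \<le> t \<and> ereal t < \<eta>'} \<phi>"
    and nonneg: "\<forall>t. 0 \<le> t \<and> ereal t < \<eta>' \<longrightarrow> 0 \<le> \<phi> t"
    and zero: "\<phi> 0 = 0"
    and der: "\<forall>t. 0 < t \<and> ereal t < \<eta>' \<longrightarrow> (\<phi> has_real_derivative \<phi>' t) (at t) \<and> 0 < \<phi>' t"
    and cont': "continuous_on {t. 0 < t \<and> ereal t < \<eta>'} \<phi>'"
    and KLi: "\<forall>x\<in>V. F z < F x \<and> F x < F z + \<eta>' \<longrightarrow>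
           1 \<le> ereal (\<phi>' (real_of_ereal (F x - F z))) *
               (INF v\<in>limiting_subdiff F x. ereal (norm v))"
    using KL unfolding KL_property_at_def by (elim conjE exE) blast
  obtain \<eta> where \<eta>: "0 < \<eta>" "ereal \<eta> < \<eta>'"
    using ereal_dense2[OF \<eta>'] by (metis ereal_less(2))
  have sub: "ereal t < \<eta>'" if "t < \<eta>" for t
    using that \<eta>(2) by (meson ereal_less_eq(3) le_less_trans less_imp_le)
  obtain \<delta> where \<delta>: "0 < \<delta>" "cball z \<delta> \<subseteq> V"
    using V open_contains_cball by blast
  show ?thesis
  proof (rule that[of \<eta> \<delta> \<phi> \<phi>'])
    show "0 \<le> \<phi> t" if "0 \<le> t" "t < \<eta>" for t
      using nonneg sub that by blast
    show "\<exists>\<mu>>0. \<forall>t. 0 \<le> t \<longrightarrow> t < \<mu> \<longrightarrow> \<phi> t < e" if "0 < e" for e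
    proof -
      have "0 \<in> {t. 0 \<le> t \<and> ereal t < \<eta>'}" using \<eta>' by (simp flip: zero_ereal_def)
      then have "\<exists>d>0. \<forall>t\<in>{t. 0 \<le> t \<and> ereal t < \<eta>'}. dist t 0 < d \<longrightarrow> dist (\<phi> t) (\<phi> 0) < e"
        using cont \<open>0 < e\<close> unfolding continuous_on_iff by blast
      then obtain d where d: "0 < d"
        "\<And>t. 0 \<le> t \<Longrightarrow> ereal t < \<eta>' \<Longrightarrow> dist t 0 < d \<Longrightarrow> dist (\<phi> t) (\<phi> 0) < e"
        by auto
      have "\<phi> t < e" if "0 \<le> t" "t < min d \<eta>" for t
        using d(2)[of t] that sub[of t] zero by (simp add: dist_real_def)
      then show ?thesis using \<open>0 < d\<close> \<open>0 < \<eta>\<close> by (intro exI[of _ "min d \<eta>"]) auto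
    qed
    show "0 < \<phi>' t" if "0 < t" "t < \<eta>" for t
      using der sub that by blast
    show "continuous_on {0<..<\<eta>} \<phi>'"
      by (rule continuous_on_subset[OF cont']) (use sub in auto)
    show "\<phi>' s * (s - t) \<le> \<phi> s - \<phi> t" if "0 < s" "s < \<eta>" "0 \<le> t" "t < \<eta>" for s t
    proof (rule concave_above_chord_slope)
      show "concave_on {0..<\<eta>} \<phi>"
        using conc sub unfolding concave_on_def
        by (elim convex_on_subset) auto
      show "s \<in> interior {0..<\<eta>}" "t \<in> {0..<\<eta>}"
        using that by auto
      show "(\<phi> has_real_derivative \<phi>' s) (at s)"
        using der sub that by blast
    qed auto
    show "1 \<le> \<phi>' s * norm v"
      if "y \<in> cball z \<delta>" "F y = ereal (c + s)" "0 < s" "s < \<eta>" "v \<in> limiting_subdiff F y" for y s v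
    proof -
      have "y \<in> V" "F z < F y" "F y - F z = ereal s"
        using \<delta>(2) that(1-3) z by auto
      moreover have "F y < F z + \<eta>'"
        using sub[OF \<open>s < \<eta>\<close>] that(2) z by (cases \<eta>') auto
      ultimately have "1 \<le> ereal (\<phi>' s) * (INF v\<in>limiting_subdiff F y. ereal (norm v))"
        using KLi by (metis real_of_ereal.simps(1))
      also have "\<dots> \<le> ereal (\<phi>' s) * ereal (norm v)"
        using der sub[OF \<open>s < \<eta>\<close>] \<open>0 < s\<close> that(5)
        by (intro ereal_mult_left_mono INF_lower) (auto simp: less_imp_le)
      finally show ?thesis by (simp add: one_ereal_def)
    qed
  qed (fact \<eta>(1) \<delta>(1) zero)+
qed

section \<open>Minimizers of \<open>h\<close> and of \<open>H_fun h \<kappa>\<close>\<close>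

text \<open>Fermat's rule: for \<open>v = 0\<close> the difference quotients at a minimizer are
  nonnegative, so 0 is a Frechet subgradient, and constant sequences make it a limiting one.\<close>

lemma local_minimizer_critical_point:
  fixes h :: "'a::euclidean_space \<Rightarrow> ereal"
  assumes "local_minimizer h x" "h x \<noteq> - \<infinity>"
  shows "critical_point h x"
proof -
  have fin: "\<bar>h x\<bar> \<noteq> \<infinity>"
    using assms by (auto simp: local_minimizer_def)
  obtain e where e: "0 < e" "\<And>y. y \<in> cball x e \<Longrightarrow> h x \<le> h y"
    using assms(1) by (auto simp: local_minimizer_def)
  have "0 \<le> Liminf (at x) (\<lambda>y. (h y - h x - ereal (0 \<bullet> (y - x))) / ereal (norm (y - x)))"
  proof (rule Liminf_bounded)
    have "eventually (\<lambda>y. y \<in> cball x e \<and> y \<noteq> x) (at x)"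
      using \<open>0 < e\<close> unfolding eventually_at by (auto simp: dist_commute intro!: exI[of _ e])
    then show "\<forall>\<^sub>F y in at x. 0 \<le> (h y - h x - ereal (0 \<bullet> (y - x))) / ereal (norm (y - x))"
    proof eventually_elim
      case (elim y)
      then have "0 \<le> h y - h x"
        using e(2)[of y] fin by (cases "h x"; cases "h y") auto
      then show ?case using elim by (simp flip: zero_ereal_def)
    qed
  qed
  then have "0 \<in> frechet_subdiff h x"
    using fin by (simp add: frechet_subdiff_def)
  then show ?thesis
    using fin unfolding critical_point_def limiting_subdiff_def mem_Collect_eq
    by (intro conjI, simp) (rule exI[of _ "\<lambda>_. x"], rule exI[of _ "\<lambda>_. 0"], simp)
qed

lemma global_imp_local_minimizer: "global_minimizer h x \<Longrightarrow> local_minimizer h x"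
  unfolding global_minimizer_def local_minimizer_def by (auto intro: exI[of _ 1])

lemma H_fun_ge: "0 \<le> \<kappa> \<Longrightarrow> h (fst z) \<le> H_fun h \<kappa> z"
  unfolding H_fun_def by (rule ereal_le_add_self) simp

lemma H_fun_diag: "H_fun h \<kappa> (x, x) = h x"
  by (simp add: H_fun_def flip: zero_ereal_def)

text \<open>The quadratic term is nonnegative and vanishes on the diagonal; moreover the first
  component of a pair near \<open>(x, x)\<close> is near \<open>x\<close>.\<close>

lemma local_minimizer_H_fun:
  assumes "local_minimizer h x" "0 \<le> \<kappa>"
  shows "local_minimizer (H_fun h \<kappa>) (x, x)"
proof -
  obtain e where e: "h x < \<infinity>" "0 < e" "\<And>y. y \<in> cball x e \<Longrightarrow> h x \<le> h y"
    using assms(1) by (auto simp: local_minimizer_def)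
  have "h x \<le> H_fun h \<kappa> z" if "z \<in> cball (x, x) e" for z
  proof -
    have "fst z \<in> cball x e"
      using that dist_fst_le[of "(x, x)" z] by simp
    then show ?thesis
      using e(3) H_fun_ge[OF assms(2), of h z] by (meson order_trans)
  qed
  then show ?thesis
    using e(1,2) unfolding local_minimizer_def H_fun_diag by blast
qed

lemma global_minimizer_H_fun:
  assumes "global_minimizer h x" "0 \<le> \<kappa>"
  shows "global_minimizer (H_fun h \<kappa>) (x, x)"
  using assms H_fun_ge[OF assms(2), of h] unfolding global_minimizer_def H_fun_diag
  by (meson order_trans)

section \<open>Estimates for single iterations\<close>

text \<open>The second component of \<open>paired x (Suc (Suc k))\<close> is
  \<open>x (Suc k)\<close>, so if this point left the ball, the growth inequality would apply to
  that pair. It would then bound the decrease of \<open>F\<close> over two iterations strictly from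
  above, whereas two descent steps give at least that decrease.\<close>

lemma growth_condition_confines:
  assumes descent: "sufficient_descent F a x" and "0 < a"
    and fin: "F (paired x (Suc (Suc k))) = ereal c"
    and growth: "\<And>y. snd y \<notin> cball xs \<delta> \<Longrightarrow>
      F (paired x k) < F y + ereal (a / 4 * (norm (snd (paired x k) - snd y))\<^sup>2)"
  shows "x (Suc k) \<in> cball xs \<delta>"
proof (rule ccontr)
  define d where "d i = norm (x i - x (i - 1))" for i
  assume "x (Suc k) \<notin> cball xs \<delta>"
  then have less: "F (paired x k) < F (paired x (Suc (Suc k)))
      + ereal (a / 4 * (norm (x (k - 1) - x (Suc k)))\<^sup>2)"
    using growth[of "paired x (Suc (Suc k))"] by (simp add: paired_def)
  have desc: "F (paired x (Suc i)) + ereal (a * (d i)\<^sup>2) \<le> F (paired x i)" for i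
    using descent by (simp add: sufficient_descent_def d_def)
  have "norm (x (k - 1) - x (Suc k)) \<le> d k + d (Suc k)"
    unfolding d_def using norm_triangle_ineq[of "x (Suc k) - x k" "x k - x (k - 1)"]
    by (simp add: norm_minus_commute)
  then have "(norm (x (k - 1) - x (Suc k)))\<^sup>2 \<le> (d k + d (Suc k))\<^sup>2"
    by (simp add: power_mono)
  also have "\<dots> \<le> 2 * ((d k)\<^sup>2 + (d (Suc k))\<^sup>2)"
    using sum_squares_bound[of "d k" "d (Suc k)"] by (simp add: power2_sum)
  \<comment> \<open>The constant 2 is relaxed to 4 in order to cancel the factor
    \<open>a / 4\<close> of the growth condition.\<close>
  also have "\<dots> \<le> 4 * ((d k)\<^sup>2 + (d (Suc k))\<^sup>2)"
    by simp
  finally have "a / 4 * (norm (x (k - 1) - x (Suc k)))\<^sup>2 \<le> a / 4 * (4 * ((d k)\<^sup>2 + (d (Suc k))\<^sup>2))"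
    using \<open>0 < a\<close> by (intro mult_left_mono) auto
  then have "a / 4 * (norm (x (k - 1) - x (Suc k)))\<^sup>2 \<le> a * (d (Suc k))\<^sup>2 + a * (d k)\<^sup>2"
    by (simp add: algebra_simps)
  then have "F (paired x (Suc (Suc k))) + ereal (a / 4 * (norm (x (k - 1) - x (Suc k)))\<^sup>2)
      \<le> F (paired x (Suc (Suc k))) + ereal (a * (d (Suc k))\<^sup>2) + ereal (a * (d k)\<^sup>2)"
    using fin by simp
  also have "\<dots> \<le> F (paired x (Suc k)) + ereal (a * (d k)\<^sup>2)"
    using desc[of "Suc k"] by (intro add_right_mono)
  also have "\<dots> \<le> F (paired x k)"
    by (rule desc)
  finally show False using less by simp
qed

text \<open>Here \<open>P\<close> stands for the derivative of \<phi> at the current gap,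
  \<open>w\<close> for the norm of a subgradient and \<open>D\<close> for the decrease of \<phi>.
  Multiplying the two bounds that contain \<open>P\<close> eliminates it and leaves a product of
  \<open>d\<^sub>0 + d\<^sub>1\<close> and \<open>D\<close>, which a weighted arithmetic-geometric
  mean inequality splits. The weight 1/4 is the one that \<open>summed_step_bound\<close>
  absorbs.\<close>

lemma KL_step_bound:
  fixes a b d\<^sub>0 d\<^sub>1 D P w :: real
  assumes pos: "0 < a" "0 < b" "0 \<le> d\<^sub>0" "0 \<le> d\<^sub>1" "0 < P"
    and KL: "1 \<le> P * w" and w: "w \<le> b / 2 * (d\<^sub>0 + d\<^sub>1)" and D: "P * (a * d\<^sub>1\<^sup>2) \<le> D"
  shows "d\<^sub>1 \<le> (d\<^sub>0 + d\<^sub>1) / 4 + b / (2 * a) * D"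
proof -
  define E where "E = d\<^sub>0 + d\<^sub>1"
  have "0 \<le> E" using pos by (simp add: E_def)
  have "0 \<le> D" using D pos by (meson mult_nonneg_nonneg less_imp_le order_trans zero_le_power2)
  have PE: "1 \<le> P * (b / 2 * E)"
    using KL mult_left_mono[OF w, of P] pos unfolding E_def by linarith
  have "a * d\<^sub>1\<^sup>2 \<le> P * (b / 2 * E) * (a * d\<^sub>1\<^sup>2)"
    using mult_right_mono[OF PE, of "a * d\<^sub>1\<^sup>2"] pos by simp
  also have "\<dots> = b / 2 * E * (P * (a * d\<^sub>1\<^sup>2))" by simp
  also have "\<dots> \<le> b / 2 * E * D"
    using D pos \<open>0 \<le> E\<close> by (intro mult_left_mono) auto
  finally have "d\<^sub>1\<^sup>2 \<le> E * (b / (2 * a) * D)"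
    using pos by (simp add: field_simps)
  \<comment> \<open>With \<open>B = b / (2 * a) * D\<close>, the difference of the two sides is
    \<open>(E / 4 - B)\<^sup>2\<close>.\<close>
  also have "\<dots> \<le> (E / 4 + b / (2 * a) * D)\<^sup>2"
    using zero_le_power2[of "E / 4 - b / (2 * a) * D"]
    by (simp add: power2_eq_square algebra_simps)
  finally have "d\<^sub>1 \<le> E / 4 + b / (2 * a) * D"
    by (rule power2_le_imp_le) (use \<open>0 \<le> E\<close> \<open>0 \<le> D\<close> pos in auto)
  then show ?thesis by (simp add: E_def)
qed

section \<open>Convergence near a local minimizer\<close>

text \<open>The distance of the starting point to \<open>xs\<close>, the sum of all steps but the last, and the last step
  are each allowed a sixth of the radius \<open>\<rho>\<close> of the growth condition. Hence the iterates stay within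
  distance \<open>\<rho> / 2\<close> of \<open>xs\<close> and the pairs \<open>z\<^sup>k\<close> within distance \<open>\<rho>\<close> of \<open>(xs, xs)\<close>.\<close>

lemma local_convergence_H_fun:
  fixes h :: "'a::euclidean_space \<Rightarrow> ereal"
  assumes xs: "h xs = ereal hs" and proper: "\<And>y. h y \<noteq> - \<infinity>"
    and "0 < e" and min: "\<forall>y\<in>cball xs e. h xs \<le> h y"
    and pos: "0 < \<kappa>" "0 < a" "0 < b"
    and growth: "growth_condition (H_fun h \<kappa>) a (xs, xs)"
    and KL: "KL_property_at (H_fun h \<kappa>) (xs, xs)"
  obtains u \<mu> :: real where "0 < u" "u < e" "0 < \<mu>"
    "\<And>x. sufficient_descent (H_fun h \<kappa>) a x \<Longrightarrow> relative_error (H_fun h \<kappa>) b x \<Longrightarrow>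
       subsequence_continuity (H_fun h \<kappa>) x \<Longrightarrow> x 0 \<in> cball xs u \<Longrightarrow>
       h (x 0) < h xs + ereal \<mu> \<Longrightarrow>
       summable (\<lambda>k. norm (x (Suc k) - x k)) \<and> (\<forall>k. x k \<in> cball xs e) \<and>
       (\<exists>xb\<in>cball xs e. x \<longlonglongrightarrow> xb \<and> h xb = h xs)"
proof -
  define F where "F = H_fun h \<kappa>"
  have Fz: "F (xs, xs) = ereal hs" by (simp add: F_def H_fun_diag xs)
  obtain \<eta> \<delta>\<^sub>0 \<phi> \<phi>' where \<eta>: "0 < \<eta>" "0 < \<delta>\<^sub>0" and \<phi>0: "\<phi> 0 = 0"
    and \<phi>_nonneg: "\<And>t. 0 \<le> t \<Longrightarrow> t < \<eta> \<Longrightarrow> 0 \<le> \<phi> t"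
    and \<phi>_small: "\<And>e. 0 < e \<Longrightarrow> \<exists>\<mu>>0. \<forall>t. 0 \<le> t \<longrightarrow> t < \<mu> \<longrightarrow> \<phi> t < e"
    and \<phi>'_pos: "\<And>t. 0 < t \<Longrightarrow> t < \<eta> \<Longrightarrow> 0 < \<phi>' t"
    and \<phi>'_cont: "continuous_on {0<..<\<eta>} \<phi>'"
    and tangent: "\<And>s t. 0 < s \<Longrightarrow> s < \<eta> \<Longrightarrow> 0 \<le> t \<Longrightarrow> t < \<eta> \<Longrightarrow> \<phi>' s * (s - t) \<le> \<phi> s - \<phi> t"
    and KL_ineq: "\<And>y s v. y \<in> cball (xs, xs) \<delta>\<^sub>0 \<Longrightarrow> F y = ereal (hs + s) \<Longrightarrow> 0 < s \<Longrightarrow> s < \<eta> \<Longrightarrow>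
           v \<in> limiting_subdiff F y \<Longrightarrow> 1 \<le> \<phi>' s * norm v"
    by (fact KL_property_atE[OF KL[folded F_def] Fz])
  \<comment> \<open>Points confined to this ball lie where \<open>xs\<close> is minimal, and \<rho>
    < \<delta> places the pairs where the Kurdyka-Lojasiewicz inequality holds.\<close>
  define \<delta> where "\<delta> = min e \<delta>\<^sub>0"
  have "0 < \<delta>" using \<open>0 < e\<close> \<eta> by (simp add: \<delta>_def)
  then obtain \<rho> \<nu> where \<rho>: "0 < \<rho>" "\<rho> < \<delta>" and "0 < \<nu>"
    and "\<forall>z y. z \<in> cball (xs, xs) \<rho> \<and> F z < F (xs, xs) + ereal \<nu> \<and> snd y \<notin> cball xs \<delta>
           \<longrightarrow> F z < F y + ereal (a / 4 * (norm (snd z - snd y))\<^sup>2)"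
    using growth unfolding growth_condition_def F_def[symmetric] snd_conv by blast
  then have grow: "\<And>z y. z \<in> cball (xs, xs) \<rho> \<Longrightarrow> F z < F (xs, xs) + ereal \<nu> \<Longrightarrow> snd y \<notin> cball xs \<delta>
           \<Longrightarrow> F z < F y + ereal (a / 4 * (norm (snd z - snd y))\<^sup>2)"
    by blast
  have \<rho>_le: "\<rho> < e" "\<rho> < \<delta>\<^sub>0" using \<rho> by (auto simp: \<delta>_def)
  define c where "c = b / (2 * a)"
  have "0 < c" using pos by (simp add: c_def)
  \<comment> \<open>The sum of steps will be at most \<open>2 * c * \<phi> (s 1)\<close>; this
    choice makes it at most \<open>\<rho> / 6\<close>.\<close>
  obtain \<mu>\<^sub>0 where \<mu>\<^sub>0: "0 < \<mu>\<^sub>0" "\<And>t. 0 \<le> t \<Longrightarrow> t < \<mu>\<^sub>0 \<Longrightarrow> \<phi> t < \<rho> / (12 * c)"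
    using \<phi>_small[of "\<rho> / (12 * c)"] \<open>0 < \<rho>\<close> \<open>0 < c\<close> by auto
  \<comment> \<open>A gap below \<mu> lies in the domain of the desingularizing function (\<eta>),
    admits the growth condition (\<nu>), keeps the sum of steps small (\<open>\<mu>\<^sub>0\<close>)
    and, through \<kappa>, keeps the newest step below \<open>\<rho> / 6\<close>.\<close>
  define \<mu> where "\<mu> = Min {\<eta>, \<nu>, \<mu>\<^sub>0, \<kappa> * (\<rho> / 6)\<^sup>2}"
  have "0 < \<mu>" using \<eta> \<open>0 < \<nu>\<close> \<mu>\<^sub>0 \<open>0 < \<rho>\<close> pos by (simp add: \<mu>_def)
  have \<mu>_le: "\<mu> \<le> \<eta>" "\<mu> \<le> \<nu>" "\<mu> \<le> \<mu>\<^sub>0" "\<mu> \<le> \<kappa> * (\<rho> / 6)\<^sup>2"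
    unfolding \<mu>_def by (auto intro: Min_le)
  show ?thesis
  proof (rule that[of "\<rho> / 6" \<mu>])
    fix x
    assume "sufficient_descent (H_fun h \<kappa>) a x" "relative_error (H_fun h \<kappa>) b x"
      and "subsequence_continuity (H_fun h \<kappa>) x"
      and x0: "x 0 \<in> cball xs (\<rho> / 6)" and hx0: "h (x 0) < h xs + ereal \<mu>"
    then have descent: "sufficient_descent F a x" and error: "relative_error F b x"
      and subseq: "subsequence_continuity F x" by (simp_all add: F_def)
    define d where "d k = norm (x k - x (k - 1))" for k
    have d0: "d 0 = 0" and d_nonneg: "0 \<le> d k" for k by (simp_all add: d_def)
    have F0: "F (paired x 0) = h (x 0)" by (simp add: F_def paired_def H_fun_diag)
    have le0: "F (paired x (Suc k)) \<le> F (paired x k)" for k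
    proof -
      have "F (paired x (Suc k)) \<le> F (paired x (Suc k)) + ereal (a * (d k)\<^sup>2)"
        using pos by (intro ereal_le_add_self) simp
      also have "\<dots> \<le> F (paired x k)"
        using descent by (simp add: sufficient_descent_def d_def)
      finally show ?thesis .
    qed
    have le_F0: "F (paired x k) \<le> F (paired x 0)" for k
      using lift_Suc_antimono_le[of "\<lambda>k. F (paired x k)" 0 k] le0 by simp
    have fin: "\<bar>F (paired x k)\<bar> \<noteq> \<infinity>" for k
    proof -
      have "F (paired x k) < \<infinity>"
        using le_F0[of k] hx0 xs unfolding F0 by (metis ereal_infty_less(1) le_less_trans less_ereal.simps(2)
            plus_ereal.simps(1))
      moreover have "F (paired x k) \<noteq> - \<infinity>"
        using proper[of "x k"] by (cases "h (x k)") (auto simp: F_def H_fun_def paired_def)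
      ultimately show ?thesis by auto
    qed
    \<comment> \<open>The gap to the minimal value is below \<mu> for every \<open>k\<close>, but
      its nonnegativity is available only once \<open>x k\<close> is known to lie in the ball of
      radius \<open>e\<close>.\<close>
    define s where "s k = real_of_ereal (F (paired x k)) - hs" for k
    have Fs: "F (paired x k) = ereal (hs + s k)" for k
      using fin[of k] by (simp add: s_def ereal_real')
    have desc: "s (Suc k) + a * (d k)\<^sup>2 \<le> s k" for k
      using descent unfolding sufficient_descent_def Fs by (simp add: d_def)
    have s_mono: "s (Suc k) \<le> s k" for k
      using le0[of k] by (simp add: Fs)
    have s_less: "s k < \<mu>" for k
      using le_F0[of k] hx0 unfolding F0[symmetric] Fs xs by simp
    have s_lower: "\<kappa> * (d k)\<^sup>2 \<le> s k" if "x k \<in> cball xs e" for k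
    proof -
      have "ereal (hs + \<kappa> * (d k)\<^sup>2) \<le> F (paired x k)"
        using bspec[OF min that] xs
        by (cases "h (x k)") (auto simp: F_def H_fun_def paired_def d_def)
      then show ?thesis by (simp add: Fs)
    qed
    have s_nonneg: "0 \<le> s k" if "x k \<in> cball xs e" for k
      using s_lower[OF that] pos by (meson less_imp_le mult_nonneg_nonneg order_trans zero_le_power2)
    have d_small: "d k \<le> \<rho> / 6" if "x k \<in> cball xs e" for k
    proof -
      have "\<kappa> * (d k)\<^sup>2 \<le> \<kappa> * (\<rho> / 6)\<^sup>2"
        using s_lower[OF that] s_less[of k] \<mu>_le(4) by linarith
      then have "(d k)\<^sup>2 \<le> (\<rho> / 6)\<^sup>2"
        using pos by simp
      then show ?thesis
        by (rule power2_le_imp_le) (use \<open>0 < \<rho>\<close> in simp)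
    qed
    have pair_in: "paired x k \<in> cball (xs, xs) \<rho>"
      if "x k \<in> cball xs (\<rho> / 2)" "x (k - 1) \<in> cball xs (\<rho> / 2)" for k
    proof -
      have "dist (xs, xs) (paired x k) \<le> dist xs (x k) + dist xs (x (k - 1))"
        unfolding paired_def dist_Pair_Pair by (rule sqrt_sum_squares_le_sum) auto
      then show ?thesis using that by simp
    qed
    have next_in: "x (Suc k) \<in> cball xs \<delta>"
      if "x k \<in> cball xs (\<rho> / 2)" "x (k - 1) \<in> cball xs (\<rho> / 2)" for k
    proof (rule growth_condition_confines[OF descent \<open>0 < a\<close> Fs])
      have "F (paired x k) < F (xs, xs) + ereal \<nu>"
        using s_less[of k] \<mu>_le(2) by (simp add: Fs Fz)
      then show "F (paired x k) < F y + ereal (a / 4 * (norm (snd (paired x k) - snd y))\<^sup>2)"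
        if "snd y \<notin> cball xs \<delta>" for y
        using grow[OF pair_in] \<open>x k \<in> _\<close> \<open>x (k - 1) \<in> _\<close> that by blast
    qed
    have KL_at: "\<exists>w. w \<le> b / 2 * (d k + d (Suc k)) \<and> 1 \<le> \<phi>' (s (Suc k)) * w"
      if "x k \<in> cball xs (\<rho> / 2)" "x (Suc k) \<in> cball xs (\<rho> / 2)" "0 < s (Suc k)" for k
    proof -
      have "\<exists>w\<in>limiting_subdiff F (paired x (Suc k)). norm w \<le> b / 2 * (d k + d (Suc k))"
        using error by (simp add: relative_error_def d_def)
      then obtain w where w: "w \<in> limiting_subdiff F (paired x (Suc k))"
        "norm w \<le> b / 2 * (d k + d (Suc k))"
        by blast
      have "paired x (Suc k) \<in> cball (xs, xs) \<delta>\<^sub>0"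
        using pair_in[of "Suc k"] that \<rho>_le(2) by simp
      then have "1 \<le> \<phi>' (s (Suc k)) * norm w"
        using KL_ineq[OF _ Fs] that(3) s_less[of "Suc k"] \<mu>_le(1) w(1) by simp
      with w(2) show ?thesis by blast
    qed
    \<comment> \<open>Bounding the step to \<open>x (Suc k)\<close> uses the gap at
      \<open>Suc (Suc k)\<close>, which must be nonnegative for the tangent inequality. Hence the
      hypothesis runs one index ahead, and the newest step always escapes the sum and needs
      \<open>d_small\<close>.\<close>
    have step: "d (Suc k) \<le> (d k + d (Suc k)) / 4 + (c * \<phi> (s (Suc k)) - c * \<phi> (s (Suc (Suc k))))"
      if prev: "x k \<in> cball xs (\<rho> / 2)" "x (Suc k) \<in> cball xs (\<rho> / 2)"
        and last: "x (Suc (Suc k)) \<in> cball xs e" for k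
    proof (cases "0 < s (Suc k)")
      case True
      obtain w where w: "w \<le> b / 2 * (d k + d (Suc k))" "1 \<le> \<phi>' (s (Suc k)) * w"
        using KL_at prev True by blast
      have P: "0 < \<phi>' (s (Suc k))"
        using \<phi>'_pos True s_less[of "Suc k"] \<mu>_le(1) by simp
      have "\<phi>' (s (Suc k)) * (a * (d (Suc k))\<^sup>2) \<le> \<phi>' (s (Suc k)) * (s (Suc k) - s (Suc (Suc k)))"
        using desc[of "Suc k"] P by (intro mult_left_mono) auto
      also have "\<dots> \<le> \<phi> (s (Suc k)) - \<phi> (s (Suc (Suc k)))"
        using True s_less[of "Suc k"] s_less[of "Suc (Suc k)"] \<mu>_le(1) s_nonneg[OF last]
        by (intro tangent) auto
      finally have "d (Suc k) \<le> (d k + d (Suc k)) / 4 + c * (\<phi> (s (Suc k)) - \<phi> (s (Suc (Suc k))))"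
        unfolding c_def by (rule KL_step_bound[OF pos(2,3) d_nonneg d_nonneg P w(2,1)])
      then show ?thesis by (simp add: right_diff_distrib)
    next
      \<comment> \<open>Without a positive gap the Kurdyka-Lojasiewicz inequality is silent, but
        descent together with minimality makes both gaps and the step vanish.\<close>
      case False
      have "s (Suc (Suc k)) + a * (d (Suc k))\<^sup>2 \<le> 0" "0 \<le> s (Suc (Suc k))"
        using False desc[of "Suc k"] s_nonneg[OF last] by auto
      moreover have "0 \<le> a * (d (Suc k))\<^sup>2" using pos by simp
      ultimately have "s (Suc (Suc k)) = 0" "s (Suc k) = 0" "a * (d (Suc k))\<^sup>2 = 0"
        using False s_mono[of "Suc k"] by linarith+
      then show ?thesis using pos d_nonneg[of k] by simp
    qed
    have sum_le: "(\<Sum>i<n. d (Suc i)) \<le> \<rho> / 6"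
      if near: "\<And>i. i \<le> n \<Longrightarrow> x i \<in> cball xs (\<rho> / 2)" and last: "x (Suc n) \<in> cball xs e" for n
    proof -
      have near_e: "x i \<in> cball xs e" if "i \<le> Suc n" for i
        using near[of i] last that \<rho>_le(1) \<open>0 < \<rho>\<close> by (cases "i = Suc n") auto
      have "(\<Sum>i<n. d (Suc i)) \<le> 2 * (c * \<phi> (s 1) - c * \<phi> (s (Suc n)))"
        using d0 d_nonneg step near near_e
        by (intro summed_step_bound[where p = "\<lambda>i. c * \<phi> (s i)"]) auto
      moreover have "c * \<phi> (s 1) \<le> \<rho> / 12"
      proof -
        have "\<phi> (s 1) < \<rho> / (12 * c)"
          using s_nonneg[OF near_e, of 1] s_less[of 1] \<mu>_le(3) by (intro \<mu>\<^sub>0(2)) auto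
        then show ?thesis using \<open>0 < c\<close> by (simp add: field_simps)
      qed
      moreover have "0 \<le> c * \<phi> (s (Suc n))"
        using s_nonneg[OF near_e, of "Suc n"] s_less[of "Suc n"] \<mu>_le(1) \<open>0 < c\<close>
        by (intro mult_nonneg_nonneg \<phi>_nonneg) auto
      ultimately show ?thesis by argo
    qed
    \<comment> \<open>The induction step has two stages. The growth condition first places
      \<open>x (Suc n)\<close> in the larger ball of radius \<open>e\<close>, which makes its gap
      nonnegative. This unlocks \<open>sum_le\<close> and \<open>d_small\<close>, and they improve
      the radius to \<open>\<rho> / 2\<close>.\<close>
    have near: "x i \<in> cball xs (\<rho> / 2)" for i
    proof (induction i rule: less_induct)
      case (less i)
      show ?case
      proof (cases i)
        case 0
        then show ?thesis using x0 \<open>0 < \<rho>\<close> by simp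
      next
        case (Suc n)
        have prev: "x j \<in> cball xs (\<rho> / 2)" if "j \<le> n" for j
          using less.IH that Suc by simp
        have last: "x (Suc n) \<in> cball xs e"
          using next_in[of n] prev[of n] prev[of "n - 1"] by (simp add: \<delta>_def)
        have split: "x (Suc n) - x 0 = (\<Sum>i<n. x (Suc i) - x i) + (x (Suc n) - x n)"
          by (simp add: sum_lessThan_telescope)
        have "norm (x (Suc n) - x 0) \<le> norm (\<Sum>i<n. x (Suc i) - x i) + norm (x (Suc n) - x n)"
          unfolding split by (rule norm_triangle_ineq)
        also have "\<dots> \<le> (\<Sum>i<n. d (Suc i)) + d (Suc n)"
          unfolding d_def diff_Suc_1 by (intro add_mono norm_sum order_refl)
        also have "\<dots> \<le> \<rho> / 6 + \<rho> / 6"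
          using sum_le[OF prev last] d_small[OF last] by linarith
        finally have "dist (x 0) (x (Suc n)) \<le> \<rho> / 3"
          by (simp add: dist_norm norm_minus_commute)
        then show ?thesis
          using x0 dist_triangle[of xs "x (Suc n)" "x 0"] Suc by simp
      qed
    qed
    have near_e: "x i \<in> cball xs e" for i
      using near[of i] \<rho>_le(1) \<open>0 < \<rho>\<close> by simp
    have summable_d: "summable (\<lambda>k. d (Suc k))"
      by (rule summableI_nonneg_bounded[OF d_nonneg sum_le[OF near near_e]])
    then have summable: "summable (\<lambda>k. norm (x (Suc k) - x k))"
      by (simp add: d_def)
    have "summable (\<lambda>k. x (Suc k) - x k)"
      by (rule summable_norm_cancel[OF summable])
    then obtain l where "(\<lambda>n. \<Sum>k<n. x (Suc k) - x k) \<longlonglongrightarrow> l"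
      unfolding summable_def sums_def by blast
    then have "(\<lambda>n. x n - x 0) \<longlonglongrightarrow> l"
      by (simp add: sum_lessThan_telescope)
    then have "(\<lambda>n. x n - x 0 + x 0) \<longlonglongrightarrow> l + x 0"
      by (intro tendsto_intros)
    then obtain xb where lim: "x \<longlonglongrightarrow> xb" by auto
    have xb: "xb \<in> cball xs e"
      using lim near_e by (intro Lim_in_closed_set[OF closed_cball _ _ lim]) auto
    \<comment> \<open>The subsequence identifies the limit of the values: its limit pair must be
      \<open>(xb, xb)\<close>, where \<open>F\<close> equals \<open>h xb\<close>.\<close>
    obtain j zt where j: "strict_mono (j :: nat \<Rightarrow> nat)" "(\<lambda>i. paired x (j i)) \<longlonglongrightarrow> zt"
      "(\<lambda>i. F (paired x (j i))) \<longlonglongrightarrow> F zt"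
      using subseq unfolding subsequence_continuity_def by blast
    have "(\<lambda>k. x (k - 1)) \<longlonglongrightarrow> xb"
      using lim by (subst filterlim_sequentially_Suc[symmetric]) simp
    then have "paired x \<longlonglongrightarrow> (xb, xb)"
      unfolding paired_def[abs_def] using lim by (intro tendsto_intros)
    then have "zt = (xb, xb)"
      using LIMSEQ_unique[OF j(2)] LIMSEQ_subseq_LIMSEQ[OF _ j(1)] by (auto simp: o_def)
    then have Flim: "(\<lambda>i. F (paired x (j i))) \<longlonglongrightarrow> h xb"
      using j(3) by (simp add: F_def H_fun_diag)
    have "decseq s" using s_mono by (rule decseq_SucI)
    then obtain sb where sb: "s \<longlonglongrightarrow> sb" and "\<forall>k. sb \<le> s k"
      using decseq_convergent[of s 0] s_nonneg[OF near_e] by blast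
    then have sb_le: "sb \<le> s k" for k by blast
    have "h xb = ereal (hs + sb)"
    proof (rule LIMSEQ_unique[OF Flim])
      have "(\<lambda>i. s (j i)) \<longlonglongrightarrow> sb"
        using LIMSEQ_subseq_LIMSEQ[OF sb j(1)] by (simp add: o_def)
      then show "(\<lambda>i. F (paired x (j i))) \<longlonglongrightarrow> ereal (hs + sb)"
        unfolding Fs by (intro tendsto_intros)
    qed
    \<comment> \<open>If the gaps stayed above a positive limit, continuity of
      \<open>\<phi>'\<close> there would keep \<open>\<phi>' (s (Suc k))\<close> bounded, while the
      steps, and with them the subgradient bounds, tend to 0. The product could not remain at least
      1.\<close>
    moreover have "sb = 0"
    proof (rule ccontr)
      assume "sb \<noteq> 0"
      moreover have "0 \<le> sb"
        using s_nonneg[OF near_e] by (intro LIMSEQ_le_const[OF sb]) auto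
      ultimately have "0 < sb" by simp
      have "sb < \<eta>" using sb_le[of 0] s_less[of 0] \<mu>_le(1) by simp
      have d_lim: "(\<lambda>k. d (Suc k)) \<longlonglongrightarrow> 0"
        by (rule summable_LIMSEQ_zero[OF summable_d])
      then have "d \<longlonglongrightarrow> 0" by (simp add: filterlim_sequentially_Suc)
      have "isCont \<phi>' sb"
        using \<phi>'_cont \<open>0 < sb\<close> \<open>sb < \<eta>\<close> by (simp add: continuous_on_eq_continuous_at)
      then have "(\<lambda>k. \<phi>' (s (Suc k))) \<longlonglongrightarrow> \<phi>' sb"
        using sb by (intro isCont_tendsto_compose[of _ \<phi>']) (simp_all add: filterlim_sequentially_Suc)
      then have "(\<lambda>k. \<phi>' (s (Suc k)) * (b / 2 * (d k + d (Suc k)))) \<longlonglongrightarrow> \<phi>' sb * (b / 2 * (0 + 0))"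
        using \<open>d \<longlonglongrightarrow> 0\<close> d_lim by (intro tendsto_intros)
      moreover have "1 \<le> \<phi>' (s (Suc k)) * (b / 2 * (d k + d (Suc k)))" for k
      proof -
        have pos_s: "0 < s (Suc k)" using sb_le \<open>0 < sb\<close> by (rule less_le_trans[rotated])
        then obtain w where w: "w \<le> b / 2 * (d k + d (Suc k))" "1 \<le> \<phi>' (s (Suc k)) * w"
          using KL_at near by blast
        have "0 < \<phi>' (s (Suc k))"
          using \<phi>'_pos pos_s s_less[of "Suc k"] \<mu>_le(1) by simp
        with w show ?thesis by (meson less_imp_le mult_left_mono order_trans)
      qed
      ultimately have "1 \<le> \<phi>' sb * (b / 2 * (0 + 0))"
        by (intro LIMSEQ_le_const) blast+
      then show False by simp
    qed
    ultimately have "h xb = h xs" by (simp add: xs)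
    then show "summable (\<lambda>k. norm (x (Suc k) - x k)) \<and> (\<forall>k. x k \<in> cball xs e) \<and>
       (\<exists>xb\<in>cball xs e. x \<longlonglongrightarrow> xb \<and> h xb = h xs)"
      using summable near_e xb lim by blast
  qed (use \<open>0 < \<rho>\<close> \<rho>_le \<open>0 < \<mu>\<close> in auto)
qed

section \<open>Criticality and local minimality of the limit\<close>

theorem corollary15:
  fixes f :: "real ^ 'n \<Rightarrow> real"
    and G :: "real ^ 'n \<Rightarrow> real ^ 'n"
    and g h :: "real ^ 'n \<Rightarrow> ereal"
    and xstar :: "real ^ 'n"
    and L \<alpha> \<beta> \<kappa> a b r' :: real
  assumes h_eq: "h = (\<lambda>x. ereal (f x) + g x)"
    and minimizer: "local_minimizer h xstar \<or> global_minimizer h xstar"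
    and r'_pos: "r' > 0"
    and problem: "ipiano_problem f G g L (cball xstar r')"
    and parameters: "admissible_parameters f g L (cball xstar r') \<alpha> \<beta>"
    and constants: "\<kappa> > 0" "a > 0" "b > 0"
  shows "(local_minimizer h xstar \<longrightarrow> local_minimizer (H_fun h \<kappa>) (xstar, xstar)) \<and>
    (global_minimizer h xstar \<longrightarrow> global_minimizer (H_fun h \<kappa>) (xstar, xstar)) \<and>
    (growth_condition (H_fun h \<kappa>) a (xstar, xstar) \<longrightarrow>
     KL_property_at (H_fun h \<kappa>) (xstar, xstar) \<longrightarrow>
     (\<exists>r0>0. \<forall>r>0. \<exists>u \<mu>. 0 < u \<and> u < r \<and> 0 < \<mu> \<and>
        (\<forall>x. ipiano_sequence f G g (cball xstar r') \<alpha> \<beta> x \<longrightarrow>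
             sufficient_descent (H_fun h \<kappa>) a x \<longrightarrow>
             relative_error (H_fun h \<kappa>) b x \<longrightarrow>
             subsequence_continuity (H_fun h \<kappa>) x \<longrightarrow>
             x 0 \<in> cball xstar u \<longrightarrow> h xstar < h (x 0) \<longrightarrow> h (x 0) < h xstar + ereal \<mu> \<longrightarrow>
               summable (\<lambda>k. norm (x (Suc k) - x k)) \<and>
               (\<forall>k. x k \<in> cball xstar r) \<and>
               (\<exists>xbar\<in>cball xstar r. x \<longlonglongrightarrow> xbar \<and> critical_point h xbar \<and> h xbar = h xstar \<and>
                  (r \<le> r0 \<longrightarrow> local_minimizer h xbar)))))"
proof (intro conjI impI)
  show "local_minimizer (H_fun h \<kappa>) (xstar, xstar)" if "local_minimizer h xstar"
    using local_minimizer_H_fun[OF that] constants by simp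
  show "global_minimizer (H_fun h \<kappa>) (xstar, xstar)" if "global_minimizer h xstar"
    using global_minimizer_H_fun[OF that] constants by simp
next
  assume growth: "growth_condition (H_fun h \<kappa>) a (xstar, xstar)"
    and KL: "KL_property_at (H_fun h \<kappa>) (xstar, xstar)"
  have "local_minimizer h xstar"
    using minimizer global_imp_local_minimizer by blast
  then obtain e where "h xstar < \<infinity>" "0 < e" and min: "\<And>y. y \<in> cball xstar e \<Longrightarrow> h xstar \<le> h y"
    unfolding local_minimizer_def by blast
  have "proper_on UNIV h"
    using problem by (simp add: ipiano_problem_def h_eq Let_def)
  then have proper: "h y \<noteq> - \<infinity>" for y by (simp add: proper_on_def)
  obtain hs where hs: "h xstar = ereal hs"
    using proper[of xstar] \<open>h xstar < \<infinity>\<close> by (cases "h xstar") auto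
  show "\<exists>r0>0. \<forall>r>0. \<exists>u \<mu>. 0 < u \<and> u < r \<and> 0 < \<mu> \<and>
        (\<forall>x. ipiano_sequence f G g (cball xstar r') \<alpha> \<beta> x \<longrightarrow>
             sufficient_descent (H_fun h \<kappa>) a x \<longrightarrow>
             relative_error (H_fun h \<kappa>) b x \<longrightarrow>
             subsequence_continuity (H_fun h \<kappa>) x \<longrightarrow>
             x 0 \<in> cball xstar u \<longrightarrow> h xstar < h (x 0) \<longrightarrow> h (x 0) < h xstar + ereal \<mu> \<longrightarrow>
               summable (\<lambda>k. norm (x (Suc k) - x k)) \<and>
               (\<forall>k. x k \<in> cball xstar r) \<and>
               (\<exists>xbar\<in>cball xstar r. x \<longlonglongrightarrow> xbar \<and> critical_point h xbar \<and> h xbar = h xstar \<and>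
                  (r \<le> r0 \<longrightarrow> local_minimizer h xbar)))"
    (is "\<exists>r0>0. \<forall>r>0. ?P r0 r")
    \<comment> \<open>\<open>r0\<close> is arbitrary: the radius \<open>r\<^sub>1\<close> below makes the limit a local minimizer for every \<open>r\<close>.\<close>
  proof (rule exI[of _ 1], intro conjI allI impI)
    show "(0::real) < 1" by simp
  next
    fix r :: real
    assume "0 < r"
    \<comment> \<open>The convergence lemma is applied with \<open>r\<^sub>1\<close> in place of
      \<open>e\<close>. Because of the bound \<open>e / 2\<close>, the ball of radius
      \<open>e / 2\<close> around any limit point stays within distance \<open>e\<close> of
      \<open>xstar\<close>, so a limit with the value \<open>h xstar\<close> is itself a local
      minimizer.\<close>
    define r\<^sub>1 where "r\<^sub>1 = min r (e / 2)"
    have r\<^sub>1: "0 < r\<^sub>1" "r\<^sub>1 \<le> r" "r\<^sub>1 \<le> e / 2"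
      using \<open>0 < r\<close> \<open>0 < e\<close> by (auto simp: r\<^sub>1_def)
    have min\<^sub>1: "\<forall>y\<in>cball xstar r\<^sub>1. h xstar \<le> h y"
      using min r\<^sub>1 \<open>0 < e\<close> by simp
    obtain u \<mu> where u: "0 < u" "u < r\<^sub>1" "0 < \<mu>" and
      conv: "\<And>x. sufficient_descent (H_fun h \<kappa>) a x \<Longrightarrow> relative_error (H_fun h \<kappa>) b x \<Longrightarrow>
       subsequence_continuity (H_fun h \<kappa>) x \<Longrightarrow> x 0 \<in> cball xstar u \<Longrightarrow>
       h (x 0) < h xstar + ereal \<mu> \<Longrightarrow>
       summable (\<lambda>k. norm (x (Suc k) - x k)) \<and> (\<forall>k. x k \<in> cball xstar r\<^sub>1) \<and>
       (\<exists>xb\<in>cball xstar r\<^sub>1. x \<longlonglongrightarrow> xb \<and> h xb = h xstar)"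
      by (fact local_convergence_H_fun[OF hs proper r\<^sub>1(1) min\<^sub>1 constants growth KL])
    have minim: "local_minimizer h xb" if "xb \<in> cball xstar r\<^sub>1" "h xb = h xstar" for xb
    proof -
      have "h xb \<le> h y" if "y \<in> cball xb (e / 2)" for y
        unfolding \<open>h xb = h xstar\<close> using that \<open>xb \<in> _\<close> r\<^sub>1(3) dist_triangle[of xstar y xb]
        by (intro min) simp
      then show ?thesis
        unfolding local_minimizer_def using \<open>h xstar < \<infinity>\<close> that(2) \<open>0 < e\<close>
        by (auto intro!: exI[of _ "e / 2"])
    qed
    have crit: "critical_point h xb" if "local_minimizer h xb" for xb
      using local_minimizer_critical_point[OF that proper] .
    have conclusion: "summable (\<lambda>k. norm (x (Suc k) - x k)) \<and> (\<forall>k. x k \<in> cball xstar r) \<and>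
        (\<exists>xbar\<in>cball xstar r. x \<longlonglongrightarrow> xbar \<and> critical_point h xbar \<and> h xbar = h xstar \<and>
           (r \<le> 1 \<longrightarrow> local_minimizer h xbar))"
      if "sufficient_descent (H_fun h \<kappa>) a x" "relative_error (H_fun h \<kappa>) b x"
        "subsequence_continuity (H_fun h \<kappa>) x" "x 0 \<in> cball xstar u"
        "h (x 0) < h xstar + ereal \<mu>" for x
    proof -
      have "cball xstar r\<^sub>1 \<subseteq> cball xstar r"
        using r\<^sub>1(2) by (simp add: subset_cball)
      then show ?thesis using conv[OF that] minim crit by blast
    qed
    have "u < r" using u r\<^sub>1 by simp
    show "?P 1 r"
      by (rule exI[of _ u], rule exI[of _ \<mu>]) (use u \<open>u < r\<close> conclusion in blast)
  qed
qed

end
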